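(* Let $X,Y$ be normed linear spaces, $\beta,\varepsilon\in[0,1)$, and let $0\neq T\in\mathcal{L}(X,Y)$ be a scalar multiple of an $\varepsilon$-isometry, with $\delta_1,\delta_2$ as in the definition of an $\varepsilon$-isometry. If $0\neq S\in\mathcal{L}(X,Y)$ satisfies $\|S-T\|\le\varepsilon\|T\|$, then: (i) $S$ is $D^\beta D^\eta$-P, where $\eta=\sqrt{1-\left(\frac{1-\delta_1(\varepsilon)-\varepsilon(1+\delta_2(\varepsilon))}{(1+\delta_2(\varepsilon))(1+\varepsilon)}\right)^2(1-\beta^2)}$; (ii) $S$ is $B^\beta D^\eta$-P for $\eta=\sqrt{1-\left(\frac{1-\delta_1(\varepsilon)-\varepsilon(1+\delta_2(\varepsilon))}{(1+\delta_2(\varepsilon))(1+\varepsilon)}\right)^2\left(\frac{1-\beta}{1+\beta}\right)^2}$; (iii) $S$ is $RD^\eta$-P and $RD^\eta$-R for $\eta=\sqrt{1-\left(\frac{1-\delta_1(\varepsilon)-\varepsilon(1+\delta_2(\varepsilon))}{(1+\delta_2(\varepsilon))(1+\varepsilon)}\right)^2}$.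
   Context: All normed spaces are real; $\mathcal{L}(X,Y)$ is the space of bounded linear operators from $X$ to $Y$ with the operator norm. For $x,y$ in a normed space and $\varepsilon\in[0,1)$: $x\perp_{D^\varepsilon}y$ means $\|x+\lambda y\|\ge\sqrt{1-\varepsilon^2}\,\|x\|$ for all $\lambda\in\mathbb{R}$; $x\perp_{B^\varepsilon}y$ means $\|x+\lambda y\|^2\ge\|x\|^2-2\varepsilon\|x\|\|\lambda y\|$ for all $\lambda\in\mathbb{R}$; $x\perp_R y$ (Roberts orthogonality) means $\|x+\lambda y\|=\|x-\lambda y\|$ for all $\lambda\in\mathbb{R}$. For $\eta\in[0,1)$ and $\Delta\in\{R,B^\beta,D^\beta\}$, an operator $S\in\mathcal{L}(X,Y)$ is $\Delta D^\eta$-P (respectively $\Delta D^\eta$-R) if for all $x,y\in X$, $x\perp_\Delta y$ implies $Sx\perp_{D^\eta}Sy$ (respectively $Sy\perp_{D^\eta}Sx$). A linear map $U:X\to Y$ is said to be an $\varepsilon$-isometry if $(1-\delta_1(\varepsilon))\|x\|\le\|Ux\|\le(1+\delta_2(\varepsilon))\|x\|$ for all $x\in X$, where $\lim_{\varepsilon\to0}\delta_1(\varepsilon)=0$ and $\lim_{\varepsilon\to0}\delta_2(\varepsilon)=0$.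
   Formalization: The formal theorem additionally assumes 1−δ₁(ε)−ε(1+δ₂(ε)) > 0; if this quantity is 0 then η = 1 is outside the admissible range, and if it is negative the claim is false in general (e.g. S = T = diag(1, 1/20), δ₁(ε) = 0.95, δ₂ = 0, ε = 3/4, β = 0). *)

theory Defs
  imports "HOL-Analysis.Analysis"
begin

definition D_orth :: "real \<Rightarrow> 'a::real_normed_vector \<Rightarrow> 'a \<Rightarrow> bool" where
  "D_orth e x y \<longleftrightarrow> (\<forall>l::real. norm (x + l *\<^sub>R y) \<ge> sqrt (1 - e\<^sup>2) * norm x)"

definition B_orth :: "real \<Rightarrow> 'a::real_normed_vector \<Rightarrow> 'a \<Rightarrow> bool" where
  "B_orth e x y \<longleftrightarrow>
     (\<forall>l::real. (norm (x + l *\<^sub>R y))\<^sup>2 \<ge> (norm x)\<^sup>2 - 2 * e * norm x * norm (l *\<^sub>R y))"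

definition R_orth :: "'a::real_normed_vector \<Rightarrow> 'a \<Rightarrow> bool" where
  "R_orth x y \<longleftrightarrow> (\<forall>l::real. norm (x + l *\<^sub>R y) = norm (x - l *\<^sub>R y))"

text \<open>
  For a relation \<open>P\<close> among \<open>R_orth\<close>, \<open>B_orth b\<close>, \<open>D_orth b\<close>, the next two
  predicates are the notions of being \<open>PD\<^sup>\<eta>\<close>-P (approximately preserving) and
  \<open>PD\<^sup>\<eta>\<close>-R (approximately reversing).  These notions only make sense for
  \<open>\<eta> \<in> [0,1)\<close>, since \<open>D_orth 1\<close> holds for all pairs of vectors; the range is therefore
  part of the definitions.
\<close>

definition D_preserving ::
  "('a::real_normed_vector \<Rightarrow> 'a \<Rightarrow> bool) \<Rightarrow> real \<Rightarrow> ('a \<Rightarrow>\<^sub>L 'b::real_normed_vector) \<Rightarrow> bool" where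
  "D_preserving P \<eta> S \<longleftrightarrow> 0 \<le> \<eta> \<and> \<eta> < 1 \<and>
     (\<forall>x y. P x y \<longrightarrow> D_orth \<eta> (blinfun_apply S x) (blinfun_apply S y))"

definition D_reversing ::
  "('a::real_normed_vector \<Rightarrow> 'a \<Rightarrow> bool) \<Rightarrow> real \<Rightarrow> ('a \<Rightarrow>\<^sub>L 'b::real_normed_vector) \<Rightarrow> bool" where
  "D_reversing P \<eta> S \<longleftrightarrow> 0 \<le> \<eta> \<and> \<eta> < 1 \<and>
     (\<forall>x y. P x y \<longrightarrow> D_orth \<eta> (blinfun_apply S y) (blinfun_apply S x))"

text \<open>
  The parameter of an approximate isometry ranges over \<open>[0,1)\<close>, so the limits of the two
  moduli at \<open>0\<close> are one-sided.  The moduli are not required to be nonnegative.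
\<close>

definition eps_isometry ::
  "(real \<Rightarrow> real) \<Rightarrow> (real \<Rightarrow> real) \<Rightarrow> real \<Rightarrow>
   ('a::real_normed_vector \<Rightarrow> 'b::real_normed_vector) \<Rightarrow> bool" where
  "eps_isometry \<delta>1 \<delta>2 e U \<longleftrightarrow>
     linear U \<and> (\<delta>1 \<longlongrightarrow> 0) (at_right 0) \<and> (\<delta>2 \<longlongrightarrow> 0) (at_right 0) \<and>
     (\<forall>x. (1 - \<delta>1 e) * norm x \<le> norm (U x) \<and> norm (U x) \<le> (1 + \<delta>2 e) * norm x)"

end

theory Submission
  imports Defs
begin

text \<open>
  Each of the three orthogonality relations bounds \<open>norm (x + l *\<^sub>R y)\<close> below by a multiple \<open>m\<close>
  of \<open>norm x\<close>.  The operator \<open>S\<close>, being close to a multiple of an approximate isometry, satisfies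
  \<open>a * norm x \<le> norm (S x) \<le> b * norm x\<close>, so the bound survives under \<open>S\<close> with \<open>m\<close>
  replaced by \<open>a / b * m\<close>.
\<close>

text \<open>The vector \<open>x\<close> is the midpoint of \<open>x + l *\<^sub>R y\<close> and
  \<open>x - l *\<^sub>R y\<close>, whose norms agree.\<close>

lemma R_orth_norm_le:
  assumes "R_orth x y"
  shows "norm x \<le> norm (x + l *\<^sub>R y)"
proof -
  have "norm ((x + l *\<^sub>R y) + (x - l *\<^sub>R y)) \<le> norm (x + l *\<^sub>R y) + norm (x - l *\<^sub>R y)"
    by (rule norm_triangle_ineq)
  moreover have "(x + l *\<^sub>R y) + (x - l *\<^sub>R y) = 2 *\<^sub>R x"
    by (simp add: scaleR_2)
  ultimately show ?thesis
    using assms by (simp add: R_orth_def)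
qed

text \<open>Factoring out \<open>l\<close> turns the condition for \<open>(y, x)\<close> at
  \<open>l\<close> into the one for \<open>(x, y)\<close> at \<open>1 / l\<close>. This symmetry
  gives the reversing claim from the preserving one.\<close>

lemma R_orth_sym:
  assumes "R_orth x y"
  shows "R_orth y x"
  unfolding R_orth_def
proof
  fix l :: real
  show "norm (y + l *\<^sub>R x) = norm (y - l *\<^sub>R x)"
  proof (cases "l = 0")
    case False
    have "y + l *\<^sub>R x = l *\<^sub>R (x + (1 / l) *\<^sub>R y)"
      and "y - l *\<^sub>R x = - (l *\<^sub>R (x - (1 / l) *\<^sub>R y))"
      using False by (simp_all add: scaleR_right_distrib scaleR_right_diff_distrib)
    then show ?thesis
      using assms by (simp only: R_orth_def norm_minus_cancel norm_scaleR)
  qed simp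
qed

text \<open>
  The quadratic inequality defining \<open>B_orth\<close> yields this stronger linear one: apply it to
  \<open>t * l\<close>, bound \<open>norm (x + (t * l) *\<^sub>R y)\<close> by convexity of the norm, and let \<open>t\<close> tend to \<open>0\<close>.
\<close>
lemma B_orth_norm_ge:
  assumes "B_orth e x y" "x \<noteq> 0"
  shows "norm x - e * norm (l *\<^sub>R y) \<le> norm (x + l *\<^sub>R y)"
proof (rule ccontr)
  \<comment> \<open>Here \<open>t * (A + t * v\<^sup>2)\<close> is
    \<open>(norm x + t * v)\<^sup>2\<close> minus the lower bound that \<open>B_orth\<close>
    supplies at \<open>t * l\<close>. If the claim fails, its first-order coefficient
    \<open>A\<close> is negative.\<close>
  define v where "v = norm (x + l *\<^sub>R y) - norm x"
  define A where "A = 2 * norm x * (v + e * norm (l *\<^sub>R y))"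
  assume "\<not> ?thesis"
  then have A: "A < 0"
    using assms(2) by (auto simp: A_def v_def mult_pos_neg)
  have ge: "0 \<le> A + t * v\<^sup>2" if t: "0 < t" "t \<le> 1" for t
  proof -
    have "x + (t * l) *\<^sub>R y = (1 - t) *\<^sub>R x + t *\<^sub>R (x + l *\<^sub>R y)"
      by (simp add: algebra_simps)
    then have "norm (x + (t * l) *\<^sub>R y) \<le> (1 - t) * norm x + t * norm (x + l *\<^sub>R y)"
      using norm_triangle_ineq[of "(1 - t) *\<^sub>R x" "t *\<^sub>R (x + l *\<^sub>R y)"] t by simp
    then have "norm (x + (t * l) *\<^sub>R y) \<le> norm x + t * v"
      by (simp add: v_def algebra_simps)
    then have "(norm (x + (t * l) *\<^sub>R y))\<^sup>2 \<le> (norm x + t * v)\<^sup>2"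
      by (rule power_mono) simp
    moreover have "(norm x)\<^sup>2 - 2 * e * norm x * norm ((t * l) *\<^sub>R y) \<le> (norm (x + (t * l) *\<^sub>R y))\<^sup>2"
      using assms(1) by (simp only: B_orth_def)
    moreover have norm_tl: "norm ((t * l) *\<^sub>R y) = t * norm (l *\<^sub>R y)"
      using t by (simp add: abs_mult)
    ultimately have "0 \<le> t * (A + t * v\<^sup>2)"
      unfolding norm_tl by (simp add: A_def power2_eq_square algebra_simps del: norm_scaleR)
    then show ?thesis
      using t by (simp add: zero_le_mult_iff)
  qed
  have v: "- A \<le> v\<^sup>2"
    using ge[of 1] by simp
  with A have "0 < v\<^sup>2"
    by linarith
  \<comment> \<open>Instead of a limit, one explicit \<open>t\<close> suffices: half the zero of
    \<open>A + t * v\<^sup>2\<close>, where the value is \<open>A / 2\<close>. The case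
    \<open>t = 1\<close> ensures that it lies in the admissible range.\<close>
  then have "0 < - A / (2 * v\<^sup>2)" "- A / (2 * v\<^sup>2) \<le> 1" "v\<^sup>2 \<noteq> 0"
    using A v by (simp_all add: divide_simps)
  then have "0 \<le> A + - A / (2 * v\<^sup>2) * v\<^sup>2"
    using ge by blast
  then show False
    using A \<open>v\<^sup>2 \<noteq> 0\<close> by simp
qed

text \<open>The linear bound degrades as \<open>norm (l *\<^sub>R y)\<close> grows, but the triangle
  inequality bounds that norm by \<open>norm (x + l *\<^sub>R y) + norm x\<close>. Solving for
  \<open>norm (x + l *\<^sub>R y)\<close> gives the ratio.\<close>

lemma B_orth_norm_ge_ratio:
  assumes "B_orth e x y" "0 \<le> e"
  shows "(1 - e) / (1 + e) * norm x \<le> norm (x + l *\<^sub>R y)"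
proof (cases "x = 0")
  case False
  have "norm (l *\<^sub>R y) \<le> norm (x + l *\<^sub>R y) + norm x"
    using norm_triangle_ineq4[of "x + l *\<^sub>R y" x] by simp
  then have "e * norm (l *\<^sub>R y) \<le> e * (norm (x + l *\<^sub>R y) + norm x)"
    using assms(2) by (rule mult_left_mono)
  then have "(1 - e) * norm x \<le> (1 + e) * norm (x + l *\<^sub>R y)"
    using B_orth_norm_ge[OF assms(1) False, of l] by (simp add: algebra_simps)
  then show ?thesis
    using assms(2) by (simp add: field_simps)
qed simp

lemma D_orth_image:
  fixes S :: "'a::real_normed_vector \<Rightarrow>\<^sub>L 'b::real_normed_vector"
  assumes "0 < a" "0 < b"
    and "\<And>x. a * norm x \<le> norm (blinfun_apply S x)"
    and "\<And>x. norm (blinfun_apply S x) \<le> b * norm x"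
    and "0 \<le> m" "a / b * m \<le> 1"
    and "\<And>l. m * norm x \<le> norm (x + l *\<^sub>R y)"
  shows "D_orth (sqrt (1 - (a / b)\<^sup>2 * m\<^sup>2)) (blinfun_apply S x) (blinfun_apply S y)"
  unfolding D_orth_def
proof
  fix l :: real
  have "0 \<le> a / b * m"
    using assms by simp
  \<comment> \<open>The radicand is thus nonnegative, so the parameter of \<open>D_orth\<close>
    encodes exactly the factor \<open>a / b * m\<close>.\<close>
  then have "(a / b)\<^sup>2 * m\<^sup>2 \<le> 1"
    using assms(6) by (metis power_le_one power_mult_distrib)
  then have "sqrt (1 - (sqrt (1 - (a / b)\<^sup>2 * m\<^sup>2))\<^sup>2) = a / b * m"
    using real_sqrt_unique[OF power_mult_distrib \<open>0 \<le> a / b * m\<close>] by simp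
  moreover have "a / b * m * norm (blinfun_apply S x) \<le> a * (m * norm x)"
    using mult_left_mono[OF assms(4)[of x] \<open>0 \<le> a / b * m\<close>] assms(2) by (simp add: ac_simps)
  moreover have "a * (m * norm x) \<le> a * norm (x + l *\<^sub>R y)"
    using assms(1,7) by simp
  moreover have "a * norm (x + l *\<^sub>R y) \<le> norm (blinfun_apply S x + l *\<^sub>R blinfun_apply S y)"
    using assms(3)[of "x + l *\<^sub>R y"] by (simp add: blinfun.add_right blinfun.scaleR_right)
  ultimately show "sqrt (1 - (sqrt (1 - (a / b)\<^sup>2 * m\<^sup>2))\<^sup>2) * norm (blinfun_apply S x)
      \<le> norm (blinfun_apply S x + l *\<^sub>R blinfun_apply S y)"
    by simp
qed

lemma sqrt_one_minus_bounds:
  assumes "0 < k" "k \<le> 1" "0 < m" "m \<le> (1::real)"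
  shows "0 \<le> sqrt (1 - k\<^sup>2 * m\<^sup>2)" "sqrt (1 - k\<^sup>2 * m\<^sup>2) < 1"
proof -
  have "k\<^sup>2 * m\<^sup>2 \<le> 1"
    using assms by (simp add: mult_le_one power_le_one)
  then show "0 \<le> sqrt (1 - k\<^sup>2 * m\<^sup>2)"
    by simp
  show "sqrt (1 - k\<^sup>2 * m\<^sup>2) < 1"
    using assms by simp
qed

text \<open>Since \<open>norm T \<le> \<bar>c\<bar> * q\<close>, the values of \<open>S\<close> and
  \<open>T\<close> at \<open>x\<close> differ by at most
  \<open>e * (\<bar>c\<bar> * q) * norm x\<close>, which shifts the two bounds for
  \<open>T\<close>.\<close>

lemma near_isometry_bounds:
  fixes S T :: "'a::real_normed_vector \<Rightarrow>\<^sub>L 'b::real_normed_vector"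
  assumes T: "T \<noteq> 0" "\<And>x. blinfun_apply T x = c *\<^sub>R U x"
    and U: "\<And>x. p * norm x \<le> norm (U x)" "\<And>x. norm (U x) \<le> q * norm x"
    and S: "norm (S - T) \<le> e * norm T"
    and e: "0 \<le> e"
  shows "0 < q" and "p \<le> q" and "c \<noteq> 0"
    and "\<bar>c\<bar> * (p - e * q) * norm x \<le> norm (blinfun_apply S x)"
    and "norm (blinfun_apply S x) \<le> \<bar>c\<bar> * (q * (1 + e)) * norm x"
proof -
  \<comment> \<open>The moduli may be negative, so the signs come from a vector with
    \<open>U z \<noteq> 0\<close>: the two-sided bound there forces \<open>0 < q\<close> and
    \<open>p \<le> q\<close>.\<close>
  obtain z where z: "blinfun_apply T z \<noteq> 0"
    using T(1) by (metis blinfun_eqI zero_blinfun.rep_eq)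
  then show "c \<noteq> 0"
    using T(2) by auto
  have "U z \<noteq> 0" "z \<noteq> 0"
    using z T(2)[of z] blinfun.zero_right[of T] by auto
  then have "0 < q * norm z" "p * norm z \<le> q * norm z"
    using U[of z] zero_less_norm_iff[of "U z"] by linarith+
  then show q: "0 < q" and "p \<le> q"
    using \<open>z \<noteq> 0\<close> by (auto simp: zero_less_mult_iff)
  have Tx: "\<bar>c\<bar> * p * norm x \<le> norm (blinfun_apply T x)"
    "norm (blinfun_apply T x) \<le> \<bar>c\<bar> * q * norm x" for x
    using U[of x] T(2)[of x] by (simp_all add: mult.assoc mult_left_mono)
  have "norm T \<le> \<bar>c\<bar> * q"
    using Tx(2) q by (intro norm_blinfun_bound) auto
  then have "norm (S - T) \<le> e * (\<bar>c\<bar> * q)"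
    using S e mult_left_mono by (blast intro: order_trans)
  then have "norm (blinfun_apply (S - T) x) \<le> e * (\<bar>c\<bar> * q) * norm x"
    using norm_blinfun[of "S - T" x] mult_right_mono[OF _ norm_ge_zero]
    by (blast intro: order_trans)
  moreover have "norm (blinfun_apply T x) - norm (blinfun_apply (S - T) x) \<le> norm (blinfun_apply S x)"
    "norm (blinfun_apply S x) \<le> norm (blinfun_apply T x) + norm (blinfun_apply (S - T) x)"
    unfolding blinfun.diff_left by norm+
  ultimately show "\<bar>c\<bar> * (p - e * q) * norm x \<le> norm (blinfun_apply S x)"
    and "norm (blinfun_apply S x) \<le> \<bar>c\<bar> * (q * (1 + e)) * norm x"
    using Tx[of x] by (simp_all add: algebra_simps)
qed

theorem theorem2p13:
  fixes S T :: "'a::real_normed_vector \<Rightarrow>\<^sub>L 'b::real_normed_vector"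
    and \<beta> \<epsilon> :: real
    and \<delta>1 \<delta>2 :: "real \<Rightarrow> real"
  assumes "0 \<le> \<beta>" "\<beta> < 1"
    and "0 \<le> \<epsilon>" "\<epsilon> < 1"
    and "T \<noteq> 0"
    and "\<exists>c U. eps_isometry \<delta>1 \<delta>2 \<epsilon> U \<and> (\<forall>x. blinfun_apply T x = c *\<^sub>R U x)"
    and "S \<noteq> 0"
    and "norm (S - T) \<le> \<epsilon> * norm T"
    and "1 - \<delta>1 \<epsilon> - \<epsilon> * (1 + \<delta>2 \<epsilon>) > 0"
  shows "D_preserving (D_orth \<beta>)
            (sqrt (1 - ((1 - \<delta>1 \<epsilon> - \<epsilon> * (1 + \<delta>2 \<epsilon>)) / ((1 + \<delta>2 \<epsilon>) * (1 + \<epsilon>)))\<^sup>2 * (1 - \<beta>\<^sup>2))) S \<and>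
         D_preserving (B_orth \<beta>)
            (sqrt (1 - ((1 - \<delta>1 \<epsilon> - \<epsilon> * (1 + \<delta>2 \<epsilon>)) / ((1 + \<delta>2 \<epsilon>) * (1 + \<epsilon>)))\<^sup>2 * ((1 - \<beta>) / (1 + \<beta>))\<^sup>2)) S \<and>
         D_preserving R_orth
            (sqrt (1 - ((1 - \<delta>1 \<epsilon> - \<epsilon> * (1 + \<delta>2 \<epsilon>)) / ((1 + \<delta>2 \<epsilon>) * (1 + \<epsilon>)))\<^sup>2)) S \<and>
         D_reversing R_orth
            (sqrt (1 - ((1 - \<delta>1 \<epsilon> - \<epsilon> * (1 + \<delta>2 \<epsilon>)) / ((1 + \<delta>2 \<epsilon>) * (1 + \<epsilon>)))\<^sup>2)) S"
proof -
  obtain c U where U: "eps_isometry \<delta>1 \<delta>2 \<epsilon> U" and T: "\<And>x. blinfun_apply T x = c *\<^sub>R U x"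
    using assms(6) by blast
  define p q where "p = 1 - \<delta>1 \<epsilon>" and "q = 1 + \<delta>2 \<epsilon>"
  have U': "\<And>x. p * norm x \<le> norm (U x)" "\<And>x. norm (U x) \<le> q * norm x"
    using U by (auto simp: eps_isometry_def p_def q_def)
  note bounds = near_isometry_bounds[OF assms(5) T U' assms(8,3)]
  define k where "k = (p - \<epsilon> * q) / (q * (1 + \<epsilon>))"
  define a b where "a = \<bar>c\<bar> * (p - \<epsilon> * q)" and "b = \<bar>c\<bar> * (q * (1 + \<epsilon>))"
  \<comment> \<open>Positivity of the numerator gives \<open>k > 0\<close>, which keeps every
    resulting parameter strictly below 1.\<close>
  have num: "0 < p - \<epsilon> * q"
    using assms(9) by (simp add: p_def q_def)
  have "0 \<le> \<epsilon> * q"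
    using assms(3) bounds(1) by simp
  have den: "0 < q * (1 + \<epsilon>)" "p - \<epsilon> * q \<le> q * (1 + \<epsilon>)"
    using bounds(1,2) assms(3) \<open>0 \<le> \<epsilon> * q\<close>
    by (simp, unfold distrib_left mult_1_right mult.commute[of q], linarith)
  have k: "0 < k" "k \<le> 1"
    using num den by (simp_all add: k_def)
  have ab: "0 < a" "0 < b" "a / b = k"
    using num den(1) bounds(3) by (simp_all add: a_def b_def k_def)
  \<comment> \<open>All parts are instances of this: \<open>m\<close> is
    \<open>sqrt (1 - \<beta>\<^sup>2)\<close> for \<open>D_orth\<close>,
    \<open>(1 - \<beta>) / (1 + \<beta>)\<close> for \<open>B_orth\<close>, and 1 for
    \<open>R_orth\<close>. The scalar \<open>\<bar>c\<bar>\<close> has cancelled in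
    \<open>a / b = k\<close>.\<close>
  have D: "0 \<le> sqrt (1 - k\<^sup>2 * m\<^sup>2) \<and> sqrt (1 - k\<^sup>2 * m\<^sup>2) < 1 \<and>
      (\<forall>x y. (\<forall>l. m * norm x \<le> norm (x + l *\<^sub>R y)) \<longrightarrow>
        D_orth (sqrt (1 - k\<^sup>2 * m\<^sup>2)) (blinfun_apply S x) (blinfun_apply S y))"
    if m: "0 < m" "m \<le> 1" for m
    using sqrt_one_minus_bounds[OF k m] m k ab
      D_orth_image[OF ab(1,2) bounds(4,5)[folded a_def b_def], of m]
    by (auto simp: mult_le_one)
  have "\<beta>\<^sup>2 < 1"
    using assms(1,2) by (simp add: abs_square_less_1)
  then have "0 < sqrt (1 - \<beta>\<^sup>2)" "sqrt (1 - \<beta>\<^sup>2) \<le> 1" "(sqrt (1 - \<beta>\<^sup>2))\<^sup>2 = 1 - \<beta>\<^sup>2"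
    by simp_all
  then have "D_preserving (D_orth \<beta>) (sqrt (1 - k\<^sup>2 * (1 - \<beta>\<^sup>2))) S"
    using D[of "sqrt (1 - \<beta>\<^sup>2)"] unfolding D_preserving_def D_orth_def[of \<beta>] by metis
  moreover have "D_preserving (B_orth \<beta>) (sqrt (1 - k\<^sup>2 * ((1 - \<beta>) / (1 + \<beta>))\<^sup>2)) S"
    using D[of "(1 - \<beta>) / (1 + \<beta>)"] assms(1,2) B_orth_norm_ge_ratio
    unfolding D_preserving_def by fastforce
  moreover have "D_preserving R_orth (sqrt (1 - k\<^sup>2)) S" "D_reversing R_orth (sqrt (1 - k\<^sup>2)) S"
    using D[of 1] R_orth_norm_le R_orth_sym
    unfolding D_preserving_def D_reversing_def by fastforce+
  ultimately show ?thesis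
    by (simp add: k_def p_def q_def)
qed

end
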